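(* Let $k\ge 1$ and let $F:L_k^2\to L_k$ be a quasitrivial nondecreasing operation. Then $F$ is bisymmetric if and only if there exist $a,b\in L_k$ ($a\le b$) and a downward-right path $\mathcal{P}=(p_j)_{j=1}^l$ (for some $l\in\mathbb{N}$) from $p_1=(1,k)$ to $p_l=(a,b)$ containing only horizontal and vertical line segments such that, with $\mathcal{Q}=(q_j)_{j=1}^l$ the reflection of $\mathcal{P}$ in the diagonal: (1) for every $(x,y)\notin\mathcal{P}\cup\mathcal{Q}\cup[a,b]^2$, $F(x,y)=x\vee y$ if $(x,y)$ is above $\mathcal{P}\cup\mathcal{Q}$, and $F(x,y)=x\wedge y$ if $(x,y)$ is below $\mathcal{P}\cup\mathcal{Q}$; (2) on $[a,b]^2$ (including $(a,b)$ and $(b,a)$), $F$ is uniformly one of the projections: either $F(x,y)=x$ for all $(x,y)\in[a,b]^2$, or $F(x,y)=y$ for all $(x,y)\in[a,b]^2$; (3) for every $i\in\{1,\dots,l-1\}$ and $(x,y)\in\{p_i,q_i\}$, $F(x,y)=x\wedge y$ if $\overline{p_i,p_{i+1}}$ is horizontal, and $F(x,y)=x\vee y$ if $\overline{p_i,p_{i+1}}$ is vertical. In particular, in this case $F$ is symmetric on $L_k^2\setminus[a,b]^2$ (i.e. $F(x,y)=F(y,x)$ there) and is one of the projections on $[a,b]^2$.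
   Context: $L_k=\{1,\dots,k\}$ with the natural order; $[a,b]=\{m\in L_k: a\le m\le b\}$; $x\wedge y=\min\{x,y\}$, $x\vee y=\max\{x,y\}$. An operation $F:L_k^2\to L_k$ is quasitrivial if $F(x,y)\in\{x,y\}$ for all $x,y$; nondecreasing if $F(x,y)\le F(x',y')$ whenever $x\le x'$ and $y\le y'$; bisymmetric if $F(F(u,v),F(w,z))=F(F(u,w),F(v,z))$ for all $u,v,w,z\in L_k$. A downward-right path is a finite sequence of points $(p_j)_{j=1}^l$ of $L_k^2$ such that each step from $p_j=(x,y)$ to $p_{j+1}$ goes to $(x+1,y)$ (the segment $\overline{p_j,p_{j+1}}$ is horizontal), to $(x,y-1)$ (vertical), or to $(x+1,y-1)$ (diagonal). We identify $\mathcal{P}$ with its set of points $\{p_1,\dots,p_l\}$. The reflection of $\mathcal{P}$ in the diagonal is $\mathcal{Q}=(q_j)_{j=1}^l$, where $q_j=(y,x)$ if $p_j=(x,y)$. Let $\mathcal{P}$ be a downward-right path from $(1,k)$ to $(a,b)$, $a\le b$, with reflection $\mathcal{Q}$, and let $(x,y)\in L_k^2\setminus(\mathcal{P}\cup\mathcal{Q}\cup[a,b]^2)$. Then $(x,y)$ is above $\mathcal{P}\cup\mathcal{Q}$ if there is $(x,w)\in\mathcal{P}$ with $y>w$, or there is $(w,y)\in\mathcal{Q}$ with $x>w$, or both $x>a$ and $y>a$. It is below $\mathcal{P}\cup\mathcal{Q}$ if there is $(x,w)\in\mathcal{P}$ with $y<w$, or there is $(w,y)\in\mathcal{Q}$ with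 $x<w$. *)

theory Defs
  imports Main
begin

definition L :: "nat \<Rightarrow> nat set" where
  "L k = {1..k}"

definition operation_on :: "'a set \<Rightarrow> ('a \<Rightarrow> 'a \<Rightarrow> 'a) \<Rightarrow> bool" where
  "operation_on X F \<longleftrightarrow> (\<forall>x\<in>X. \<forall>y\<in>X. F x y \<in> X)"

definition quasitrivial_on :: "'a set \<Rightarrow> ('a \<Rightarrow> 'a \<Rightarrow> 'a) \<Rightarrow> bool" where
  "quasitrivial_on X F \<longleftrightarrow> (\<forall>x\<in>X. \<forall>y\<in>X. F x y \<in> {x, y})"

definition nondecreasing_on :: "'a::order set \<Rightarrow> ('a \<Rightarrow> 'a \<Rightarrow> 'a) \<Rightarrow> bool" where
  "nondecreasing_on X F \<longleftrightarrow>
     (\<forall>x\<in>X. \<forall>x'\<in>X. \<forall>y\<in>X. \<forall>y'\<in>X. x \<le> x' \<and> y \<le> y' \<longrightarrow> F x y \<le> F x' y')"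

definition bisymmetric_on :: "'a set \<Rightarrow> ('a \<Rightarrow> 'a \<Rightarrow> 'a) \<Rightarrow> bool" where
  "bisymmetric_on X F \<longleftrightarrow>
     (\<forall>u\<in>X. \<forall>v\<in>X. \<forall>w\<in>X. \<forall>z\<in>X. F (F u v) (F w z) = F (F u w) (F v z))"

definition projection_on :: "'a set \<Rightarrow> ('a \<Rightarrow> 'a \<Rightarrow> 'a) \<Rightarrow> bool" where
  "projection_on X F \<longleftrightarrow>
     (\<forall>x\<in>X. \<forall>y\<in>X. F x y = x) \<or> (\<forall>x\<in>X. \<forall>y\<in>X. F x y = y)"

definition horizontal_step :: "nat \<times> nat \<Rightarrow> nat \<times> nat \<Rightarrow> bool" where
  "horizontal_step p q \<longleftrightarrow> fst q = fst p + 1 \<and> snd q = snd p"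

text \<open>A downward step from y to y' is written y' + 1 = y, which avoids truncated subtraction.\<close>

definition vertical_step :: "nat \<times> nat \<Rightarrow> nat \<times> nat \<Rightarrow> bool" where
  "vertical_step p q \<longleftrightarrow> fst q = fst p \<and> snd q + 1 = snd p"

definition diagonal_step :: "nat \<times> nat \<Rightarrow> nat \<times> nat \<Rightarrow> bool" where
  "diagonal_step p q \<longleftrightarrow> fst q = fst p + 1 \<and> snd q + 1 = snd p"

text \<open>A path is the list of its points, so the point with index i + 1 in
  mathematical notation is \<open>P ! i\<close> and the identification of a path with its set of points
  is \<open>set P\<close>.\<close>

definition downward_right_path :: "nat \<Rightarrow> (nat \<times> nat) list \<Rightarrow> bool" where
  "downward_right_path k P \<longleftrightarrow>
     P \<noteq> [] \<and> set P \<subseteq> L k \<times> L k \<and>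
     (\<forall>i. i + 1 < length P \<longrightarrow>
        horizontal_step (P ! i) (P ! (i + 1)) \<or>
        vertical_step (P ! i) (P ! (i + 1)) \<or>
        diagonal_step (P ! i) (P ! (i + 1)))"

definition path_from_to ::
  "nat \<Rightarrow> (nat \<times> nat) list \<Rightarrow> nat \<times> nat \<Rightarrow> nat \<times> nat \<Rightarrow> bool" where
  "path_from_to k P s t \<longleftrightarrow> downward_right_path k P \<and> hd P = s \<and> last P = t"

definition only_horizontal_vertical :: "(nat \<times> nat) list \<Rightarrow> bool" where
  "only_horizontal_vertical P \<longleftrightarrow>
     (\<forall>i. i + 1 < length P \<longrightarrow>
        horizontal_step (P ! i) (P ! (i + 1)) \<or> vertical_step (P ! i) (P ! (i + 1)))"

definition reflection :: "(nat \<times> nat) list \<Rightarrow> (nat \<times> nat) list" where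
  "reflection P = map prod.swap P"

text \<open>The points of \<open>L k \<times> L k\<close> outside the path, its reflection and the square
  over \<open>[a, b]\<close>. The predicates \<open>above\<close> and \<open>below\<close> are meant for these points only.\<close>

definition off_path :: "nat \<Rightarrow> nat \<Rightarrow> nat \<Rightarrow> (nat \<times> nat) list \<Rightarrow> (nat \<times> nat) set" where
  "off_path k a b P =
     L k \<times> L k - (set P \<union> set (reflection P) \<union> {a..b} \<times> {a..b})"

definition above :: "nat \<Rightarrow> (nat \<times> nat) list \<Rightarrow> nat \<Rightarrow> nat \<Rightarrow> bool" where
  "above a P x y \<longleftrightarrow>
     (\<exists>w. (x, w) \<in> set P \<and> y > w) \<or>
     (\<exists>w. (w, y) \<in> set (reflection P) \<and> x > w) \<or>
     (x > a \<and> y > a)"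

definition below :: "(nat \<times> nat) list \<Rightarrow> nat \<Rightarrow> nat \<Rightarrow> bool" where
  "below P x y \<longleftrightarrow>
     (\<exists>w. (x, w) \<in> set P \<and> y < w) \<or>
     (\<exists>w. (w, y) \<in> set (reflection P) \<and> x < w)"

definition described_by_path ::
  "nat \<Rightarrow> (nat \<Rightarrow> nat \<Rightarrow> nat) \<Rightarrow> nat \<Rightarrow> nat \<Rightarrow> (nat \<times> nat) list \<Rightarrow> bool" where
  "described_by_path k F a b P \<longleftrightarrow>
     a \<in> L k \<and> b \<in> L k \<and> a \<le> b \<and>
     path_from_to k P (1, k) (a, b) \<and> only_horizontal_vertical P \<and>
     (\<forall>(x, y)\<in>off_path k a b P.
        (above a P x y \<longrightarrow> F x y = max x y) \<and> (below P x y \<longrightarrow> F x y = min x y)) \<and>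
     projection_on {a..b} F \<and>
     (\<forall>i. i + 1 < length P \<longrightarrow> (\<forall>(x, y)\<in>{P ! i, reflection P ! i}.
        (horizontal_step (P ! i) (P ! (i + 1)) \<longrightarrow> F x y = min x y) \<and>
        (vertical_step (P ! i) (P ! (i + 1)) \<longrightarrow> F x y = max x y)))"

end

theory Submission
  imports Defs
begin

text \<open>A quasitrivial nondecreasing operation on an interval \<open>[c, d]\<close> with
  \<open>F c d = F d c\<close> has this common value as an annihilator, so an endpoint can be peeled off:
  a horizontal step of the path removes an annihilator \<open>c\<close>, a vertical step an
  annihilator \<open>d\<close>. If \<open>F c d \<noteq> F d c\<close>, bisymmetry forces \<open>F\<close> to be a
  projection on \<open>[c, d]\<close>. Conversely, adding an annihilator to a carrier preserves
  bisymmetry.\<close>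

section \<open>Peelings of an interval, and path descriptions relative to an interval\<close>

definition annihilator_on :: "'a set \<Rightarrow> ('a \<Rightarrow> 'a \<Rightarrow> 'a) \<Rightarrow> 'a \<Rightarrow> bool" where
  "annihilator_on X F e \<longleftrightarrow> (\<forall>x\<in>X. F e x = e \<and> F x e = e)"

text \<open>The head of the list is the corner \<open>(c, d)\<close> of the current interval, so the
  rules grow the path backwards from \<open>(a, b)\<close>, one annihilating endpoint at a
  time.\<close>

inductive peeling :: "(nat \<Rightarrow> nat \<Rightarrow> nat) \<Rightarrow> nat \<Rightarrow> nat \<Rightarrow> nat \<Rightarrow> nat \<Rightarrow> (nat \<times> nat) list \<Rightarrow> bool"
  for F a b where
  stop: "a \<le> b \<Longrightarrow> projection_on {a..b} F \<Longrightarrow> peeling F a b a b [(a, b)]"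
| horizontal: "annihilator_on {c..d} F c \<Longrightarrow> peeling F a b (Suc c) d P \<Longrightarrow>
    peeling F a b c d ((c, d) # P)"
| vertical: "annihilator_on {c..Suc d} F (Suc d) \<Longrightarrow> peeling F a b c d P \<Longrightarrow>
    peeling F a b c (Suc d) ((c, Suc d) # P)"

text \<open>Direction of a step and values of \<open>F\<close> at its start are merged into one
  relation, so that all conditions along a path become a single \<open>successively\<close>, which
  unfolds along \<open>Cons\<close>.\<close>

definition labelled_step ::
  "(nat \<Rightarrow> nat \<Rightarrow> nat) \<Rightarrow> nat \<times> nat \<Rightarrow> nat \<times> nat \<Rightarrow> bool" where
  "labelled_step F p q \<longleftrightarrow>
     (horizontal_step p q \<and> (\<forall>(x, y)\<in>{p, prod.swap p}. F x y = min x y)) \<or>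
     (vertical_step p q \<and> (\<forall>(x, y)\<in>{p, prod.swap p}. F x y = max x y))"

text \<open>The description in the theorem with \<open>{1..k}\<close> replaced by an arbitrary
  interval, so that induction can shrink or enlarge it.\<close>

definition described_on ::
  "(nat \<Rightarrow> nat \<Rightarrow> nat) \<Rightarrow> nat \<Rightarrow> nat \<Rightarrow> nat \<Rightarrow> nat \<Rightarrow> (nat \<times> nat) list \<Rightarrow> bool" where
  "described_on F a b c d P \<longleftrightarrow>
     a \<in> {c..d} \<and> b \<in> {c..d} \<and> a \<le> b \<and>
     P \<noteq> [] \<and> set P \<subseteq> {c..d} \<times> {c..d} \<and> hd P = (c, d) \<and> last P = (a, b) \<and>
     successively (labelled_step F) P \<and>
     (\<forall>x\<in>{c..d}. \<forall>y\<in>{c..d}. (x, y) \<notin> set P \<longrightarrow> (y, x) \<notin> set P \<longrightarrow>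
        (x, y) \<notin> {a..b} \<times> {a..b} \<longrightarrow>
        (above a P x y \<longrightarrow> F x y = max x y) \<and> (below P x y \<longrightarrow> F x y = min x y)) \<and>
     projection_on {a..b} F"

lemma swap_mem_reflection [simp]: "(x, y) \<in> set (reflection P) \<longleftrightarrow> (y, x) \<in> set P"
  by (force simp: reflection_def)

text \<open>No step is both horizontal and vertical, so a disjunction of directions with one
  implication per direction amounts to a disjunction of conjunctions.\<close>

lemma steps_iff_successively:
  "(only_horizontal_vertical P \<and>
    (\<forall>i. i + 1 < length P \<longrightarrow> (\<forall>(x, y)\<in>{P ! i, reflection P ! i}.
        (horizontal_step (P ! i) (P ! (i + 1)) \<longrightarrow> F x y = min x y) \<and>
        (vertical_step (P ! i) (P ! (i + 1)) \<longrightarrow> F x y = max x y))))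
   \<longleftrightarrow> successively (labelled_step F) P"
proof -
  have excl: "\<not> (horizontal_step p q \<and> vertical_step p q)" for p q
    by (auto simp: horizontal_step_def vertical_step_def)
  have "((horizontal_step (P ! i) (P ! (i + 1)) \<or> vertical_step (P ! i) (P ! (i + 1))) \<and>
      (\<forall>(x, y)\<in>{P ! i, reflection P ! i}.
        (horizontal_step (P ! i) (P ! (i + 1)) \<longrightarrow> F x y = min x y) \<and>
        (vertical_step (P ! i) (P ! (i + 1)) \<longrightarrow> F x y = max x y)))
    \<longleftrightarrow> labelled_step F (P ! i) (P ! (i + 1))" if "i + 1 < length P" for i
  proof -
    have "reflection P ! i = prod.swap (P ! i)"
      using that by (simp add: reflection_def)
    then show ?thesis
      using excl[of "P ! i" "P ! (i + 1)"] unfolding labelled_step_def by auto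
  qed
  then show ?thesis
    unfolding only_horizontal_vertical_def successively_conv_nth Suc_eq_plus1 by blast
qed

lemma described_by_path_iff:
  "described_by_path k F a b P \<longleftrightarrow> described_on F a b 1 k P"
proof -
  have path: "path_from_to k P (1, k) (a, b) \<and> only_horizontal_vertical P \<longleftrightarrow>
    P \<noteq> [] \<and> set P \<subseteq> L k \<times> L k \<and> hd P = (1, k) \<and> last P = (a, b) \<and>
    only_horizontal_vertical P"
    by (auto simp: path_from_to_def downward_right_path_def only_horizontal_vertical_def)
  have off: "(\<forall>(x, y)\<in>off_path k a b P. Q x y) \<longleftrightarrow>
    (\<forall>x\<in>{1..k}. \<forall>y\<in>{1..k}. (x, y) \<notin> set P \<longrightarrow> (y, x) \<notin> set P \<longrightarrow>
        (x, y) \<notin> {a..b} \<times> {a..b} \<longrightarrow> Q x y)" for Q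
    unfolding off_path_def L_def by fastforce
  show ?thesis
    unfolding described_by_path_def described_on_def off steps_iff_successively[symmetric]
    using path unfolding L_def by blast
qed

text \<open>Going backwards, each rule lowers the first coordinate or raises the second. The
  resulting rectangle later decides on which side of the path a point lies.\<close>

lemma peeling_bounds:
  assumes "peeling F a b c d P"
  shows "c \<le> a \<and> a \<le> b \<and> b \<le> d \<and> P \<noteq> [] \<and> hd P = (c, d) \<and> last P = (a, b) \<and>
    set P \<subseteq> {c..a} \<times> {b..d}"
  using assms by induction fastforce+

section \<open>From bisymmetry to a peeling\<close>

lemma quasitrivial_on_subset:
  "quasitrivial_on X F \<Longrightarrow> Y \<subseteq> X \<Longrightarrow> quasitrivial_on Y F"
  unfolding quasitrivial_on_def by blast

lemma nondecreasing_on_subset: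
  "nondecreasing_on X F \<Longrightarrow> Y \<subseteq> X \<Longrightarrow> nondecreasing_on Y F"
  unfolding nondecreasing_on_def by blast

lemma bisymmetric_on_subset:
  "bisymmetric_on X F \<Longrightarrow> Y \<subseteq> X \<Longrightarrow> bisymmetric_on Y F"
  unfolding bisymmetric_on_def by blast

text \<open>Monotonicity bounds \<open>F c x\<close> and \<open>F x c\<close> by \<open>c\<close>;
  quasitriviality leaves only \<open>c\<close> and \<open>x\<close>, and \<open>c\<close> is the
  least element.\<close>

lemma annihilator_on_lower:
  fixes F :: "nat \<Rightarrow> nat \<Rightarrow> nat"
  assumes "quasitrivial_on {c..d} F" "nondecreasing_on {c..d} F" "F c d = c" "F d c = c"
  shows "annihilator_on {c..d} F c"
  unfolding annihilator_on_def
proof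
  fix x assume x: "x \<in> {c..d}"
  then have "F c x \<le> F c d" "F x c \<le> F d c"
    using assms(2) unfolding nondecreasing_on_def by simp_all
  moreover have "F c x \<in> {c, x}" "F x c \<in> {x, c}"
    using assms(1) x unfolding quasitrivial_on_def by simp_all
  ultimately show "F c x = c \<and> F x c = c" using x assms(3,4) by auto
qed

lemma annihilator_on_upper:
  fixes F :: "nat \<Rightarrow> nat \<Rightarrow> nat"
  assumes "quasitrivial_on {c..d} F" "nondecreasing_on {c..d} F" "F c d = d" "F d c = d"
  shows "annihilator_on {c..d} F d"
  unfolding annihilator_on_def
proof
  fix x assume x: "x \<in> {c..d}"
  then have "F d c \<le> F d x" "F c d \<le> F x d"
    using assms(2) unfolding nondecreasing_on_def by simp_all
  moreover have "F d x \<in> {d, x}" "F x d \<in> {x, d}"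
    using assms(1) x unfolding quasitrivial_on_def by simp_all
  ultimately show "F d x = d \<and> F x d = d" using x assms(3,4) by auto
qed

text \<open>Monotonicity makes the rows of \<open>c\<close> and \<open>d\<close> constant.
  Bisymmetry then yields \<open>F x c = x\<close> and \<open>F x d = x\<close>, and
  \<open>F x y\<close> is squeezed between these values.\<close>

lemma first_projection_on_interval:
  fixes F :: "nat \<Rightarrow> nat \<Rightarrow> nat"
  assumes q: "quasitrivial_on {c..d} F" and n: "nondecreasing_on {c..d} F"
    and bi: "bisymmetric_on {c..d} F"
    and "c < d" "F c d = c" "F d c = d" and x: "x \<in> {c..d}" and y: "y \<in> {c..d}"
  shows "F x y = x"
proof -
  have cd: "c \<in> {c..d}" "d \<in> {c..d}" using \<open>c < d\<close> by auto
  have "F c c \<le> F c x" "F c x \<le> F c d" "F d c \<le> F d x" "F d x \<le> F d d"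
    using n cd x unfolding nondecreasing_on_def by simp_all
  moreover have id: "F z z = z" if "z \<in> {c..d}" for z
    using q that unfolding quasitrivial_on_def by blast
  ultimately have row: "F c x = c" "F d x = d"
    using assms(5,6) cd by auto
  have bis: "F (F u v) (F w z) = F (F u w) (F v z)"
    if "u \<in> {c..d}" "v \<in> {c..d}" "w \<in> {c..d}" "z \<in> {c..d}" for u v w z
    using bi that unfolding bisymmetric_on_def by blast
  have 1: "F x c = F (F x c) (F x d)" "F x d = F (F x d) (F x c)" "F (F x c) d = F (F x d) c"
    using bis[OF x x cd] bis[OF x x cd(2,1)] bis[OF x cd(1,2,1)] id x cd assms(5,6)
    by simp_all
  have "F x c \<in> {x, c}" "F x d \<in> {x, d}"
    using q x cd unfolding quasitrivial_on_def by simp_all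
  \<comment> \<open>If \<open>F x c = c\<close> and \<open>F x d = d\<close>, the third equation
    becomes \<open>F c d = F d c\<close>, hence \<open>c = d\<close>. If \<open>F x c = c\<close>
    and \<open>F x d = x\<close>, the second gives \<open>x = c\<close>; if \<open>F x c = x\<close>
    and \<open>F x d = d\<close>, the first gives \<open>x = d\<close>.\<close>
  with 1 row assms(5,6) \<open>c < d\<close> have "F x c = x" "F x d = x" by auto
  moreover have "F x c \<le> F x y" "F x y \<le> F x d"
    using n cd x y unfolding nondecreasing_on_def by simp_all
  ultimately show ?thesis by simp
qed

lemma projection_on_interval:
  fixes F :: "nat \<Rightarrow> nat \<Rightarrow> nat"
  assumes q: "quasitrivial_on {c..d} F" and n: "nondecreasing_on {c..d} F"
    and bi: "bisymmetric_on {c..d} F" and cd: "c < d" and ne: "F c d \<noteq> F d c"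
  shows "projection_on {c..d} F"
proof -
  have "F c d \<in> {c, d}" "F d c \<in> {d, c}"
    using q cd unfolding quasitrivial_on_def by simp_all
  with ne consider "F c d = c" "F d c = d" | "F c d = d" "F d c = c" by auto
  then show ?thesis
  proof cases
    case 1
    then show ?thesis
      using first_projection_on_interval[OF q n bi cd] unfolding projection_on_def by blast
  next
    case 2
    \<comment> \<open>Exchanging the arguments of \<open>F\<close> preserves the hypotheses and
      turns this case into the previous one.\<close>
    have "F x y = y" if "x \<in> {c..d}" "y \<in> {c..d}" for x y
    proof (rule first_projection_on_interval[of c d "\<lambda>x y. F y x"])
      show "quasitrivial_on {c..d} (\<lambda>x y. F y x)"
        using q unfolding quasitrivial_on_def by blast
      show "nondecreasing_on {c..d} (\<lambda>x y. F y x)"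
        using n unfolding nondecreasing_on_def by blast
      show "bisymmetric_on {c..d} (\<lambda>x y. F y x)"
        using bi unfolding bisymmetric_on_def by simp
    qed (use 2 cd that in auto)
    then show ?thesis unfolding projection_on_def by blast
  qed
qed

text \<open>If \<open>F c d\<close> and \<open>F d c\<close> differ, \<open>F\<close> is a
  projection and the peeling stops; if they agree, their value is an annihilating endpoint, and the
  hypotheses restrict to the interval without it.\<close>

lemma peeling_if_bisymmetric:
  fixes F :: "nat \<Rightarrow> nat \<Rightarrow> nat"
  assumes "quasitrivial_on {c..d} F" "nondecreasing_on {c..d} F"
    "bisymmetric_on {c..d} F" "c \<le> d"
  shows "\<exists>a b P. peeling F a b c d P"
  using assms
proof (induction "d - c" arbitrary: c d)
  case 0
  then have "d = c" by simp
  moreover have "projection_on {c..c} F"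
    using "0.prems" \<open>d = c\<close> by (auto simp: projection_on_def quasitrivial_on_def)
  ultimately show ?case using peeling.stop[of c c F] by blast
next
  case (Suc n)
  note qnb = Suc.prems(1-3)
  have cd: "c < d" using Suc.hyps(2) by simp
  have "F c d \<in> {c, d}"
    using qnb(1) cd unfolding quasitrivial_on_def by simp
  then consider "F c d \<noteq> F d c" | "F c d = c" "F d c = c" | "F c d = d" "F d c = d"
    by fastforce
  then show ?case
  proof cases
    case 1
    then show ?thesis
      using projection_on_interval[OF qnb cd] peeling.stop[of c d F] cd less_imp_le by blast
  next
    case 2
    have sub: "{Suc c..d} \<subseteq> {c..d}" by auto
    have "\<exists>a b P. peeling F a b (Suc c) d P"
      using Suc.hyps cd quasitrivial_on_subset[OF qnb(1) sub]
        nondecreasing_on_subset[OF qnb(2) sub] bisymmetric_on_subset[OF qnb(3) sub] by simp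
    then show ?thesis
      using annihilator_on_lower[OF qnb(1,2) 2] peeling.horizontal by blast
  next
    case 3
    obtain e where e: "d = Suc e" using cd by (cases d) auto
    have sub: "{c..e} \<subseteq> {c..d}" using e by auto
    have "\<exists>a b P. peeling F a b c e P"
      using Suc.hyps cd e quasitrivial_on_subset[OF qnb(1) sub]
        nondecreasing_on_subset[OF qnb(2) sub] bisymmetric_on_subset[OF qnb(3) sub] by simp
    then show ?thesis
      using annihilator_on_upper[OF qnb(1,2) 3] peeling.vertical e by blast
  qed
qed

section \<open>From a peeling to bisymmetry and symmetry\<close>

text \<open>If \<open>e\<close> is among the four arguments, it is absorbed through both levels and
  both sides equal \<open>e\<close>; otherwise all four lie in \<open>X\<close>.\<close>

lemma bisymmetric_on_insert_annihilator:
  assumes q: "quasitrivial_on (insert e X) F" and ann: "annihilator_on (insert e X) F e"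
    and bi: "bisymmetric_on X F"
  shows "bisymmetric_on (insert e X) F"
proof -
  have closed: "F x y \<in> insert e X" if "x \<in> insert e X" "y \<in> insert e X" for x y
    using q that unfolding quasitrivial_on_def by (metis insertE singletonD)
  have e: "F e x = e" "F x e = e" if "x \<in> insert e X" for x
    using ann that unfolding annihilator_on_def by auto
  show ?thesis
    unfolding bisymmetric_on_def
  proof (intro ballI)
    fix u v w z
    assume mem: "u \<in> insert e X" "v \<in> insert e X" "w \<in> insert e X" "z \<in> insert e X"
    show "F (F u v) (F w z) = F (F u w) (F v z)"
    proof (cases "e \<in> {u, v, w, z}")
      case True
      have "F u v \<in> insert e X" "F w z \<in> insert e X" "F u w \<in> insert e X" "F v z \<in> insert e X"
        using mem closed by blast+
      note rules = this mem e
      from True consider "u = e" | "v = e" | "w = e" | "z = e" by blast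
      then show ?thesis by cases (simp_all only: rules)
    next
      case False
      then show ?thesis using mem bi unfolding bisymmetric_on_def by auto
    qed
  qed
qed

lemma bisymmetric_if_peeling:
  assumes "peeling F a b c d P" "quasitrivial_on {c..d} F"
  shows "bisymmetric_on {c..d} F"
  using assms
proof induction
  case stop
  then show ?case
    unfolding projection_on_def bisymmetric_on_def by auto
next
  case (horizontal c d P)
  have eq: "{c..d} = insert c {Suc c..d}" using peeling_bounds[OF horizontal.hyps(2)] by auto
  have "bisymmetric_on {Suc c..d} F"
    using horizontal.IH quasitrivial_on_subset[OF horizontal.prems] by auto
  then show ?case
    using horizontal.hyps(1) horizontal.prems
    unfolding eq by (intro bisymmetric_on_insert_annihilator)
next
  case (vertical c d P)
  have eq: "{c..Suc d} = insert (Suc d) {c..d}"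
    using peeling_bounds[OF vertical.hyps(2)] by auto
  have "bisymmetric_on {c..d} F"
    using vertical.IH quasitrivial_on_subset[OF vertical.prems] by auto
  then show ?case
    using vertical.hyps(1) vertical.prems
    unfolding eq by (intro bisymmetric_on_insert_annihilator)
qed

text \<open>The row and column of a peeled endpoint carry one constant value; the innermost interval
  gives exactly the excluded square.\<close>

lemma symmetric_if_peeling:
  assumes "peeling F a b c d P" "x \<in> {c..d}" "y \<in> {c..d}" "(x, y) \<notin> {a..b} \<times> {a..b}"
  shows "F x y = F y x"
  using assms
proof induction
  case stop
  then show ?case by simp
next
  case (horizontal c d P)
  show ?case
  proof (cases "x = c \<or> y = c")
    case True
    then show ?thesis using horizontal by (auto simp: annihilator_on_def)
  next
    case False
    then show ?thesis using horizontal by auto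
  qed
next
  case (vertical c d P)
  show ?case
  proof (cases "x = Suc d \<or> y = Suc d")
    case True
    then show ?thesis using vertical by (auto simp: annihilator_on_def)
  next
    case False
    then show ?thesis using vertical by auto
  qed
qed

lemma projection_if_peeling: "peeling F a b c d P \<Longrightarrow> projection_on {a..b} F"
  by (induction rule: peeling.induct)

section \<open>From a peeling to the path description\<close>

text \<open>On the row and column added by a rule, \<open>F\<close> is constantly the new endpoint:
  \<open>min\<close> for a horizontal step, \<open>max\<close> for a vertical one. It remains to
  show that no point there lies on the opposite side of the path.\<close>

lemma described_if_peeling:
  assumes "peeling F a b c d P"
  shows "described_on F a b c d P"
  using assms
proof induction
  case stop
  then show ?case by (auto simp: described_on_def)
next
  case (horizontal c d P)
  note bounds = peeling_bounds[OF horizontal.hyps(2)]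
  then obtain P' where P: "P = (Suc c, d) # P'" by (cases P) auto
  have ann: "F c x = c" "F x c = c" if "c \<le> x" "x \<le> d" for x
    using horizontal.hyps(1) that by (auto simp: annihilator_on_def)
  have P_bounds: "Suc c \<le> x" "x \<le> a" "y \<le> d" "b \<le> y" if "(x, y) \<in> set P" for x y
    using bounds that by auto
  have "labelled_step F (c, d) (Suc c, d)"
    using bounds ann by (auto simp: labelled_step_def horizontal_step_def)
  moreover have "(above a ((c, d) # P) x y \<longrightarrow> F x y = max x y) \<and>
      (below ((c, d) # P) x y \<longrightarrow> F x y = min x y)"
    if xy: "x \<in> {c..d}" "y \<in> {c..d}" "(x, y) \<notin> set ((c, d) # P)" "(y, x) \<notin> set ((c, d) # P)"
      "(x, y) \<notin> {a..b} \<times> {a..b}" for x y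
  proof (cases "x = c \<or> y = c")
    case True
    \<comment> \<open>The only path point with abscissa \<open>c\<close> is \<open>(c, d)\<close>,
      at maximal height; all ordinates on the path, and \<open>a\<close>, exceed \<open>c\<close>.
      This excludes all three ways of being above.\<close>
    have "\<not> above a ((c, d) # P) x y"
      using True xy bounds P_bounds unfolding above_def by fastforce
    then show ?thesis using True xy ann by auto
  next
    case False
    then have "above a ((c, d) # P) x y = above a P x y" "below ((c, d) # P) x y = below P x y"
      by (auto simp: above_def below_def)
    then show ?thesis using horizontal.IH False xy by (auto simp: described_on_def)
  qed
  moreover have "successively (labelled_step F) P" "projection_on {a..b} F"
    using horizontal.IH by (auto simp: described_on_def)
  moreover have "set ((c, d) # P) \<subseteq> {c..d} \<times> {c..d}"
    using bounds by fastforce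
  ultimately show ?case
    using bounds unfolding described_on_def
    by (intro conjI ballI impI) (simp_all add: successively_Cons)
next
  case (vertical c d P)
  note bounds = peeling_bounds[OF vertical.hyps(2)]
  then obtain P' where P: "P = (c, d) # P'" by (cases P) auto
  have ann: "F (Suc d) x = Suc d" "F x (Suc d) = Suc d" if "c \<le> x" "x \<le> Suc d" for x
    using vertical.hyps(1) that by (auto simp: annihilator_on_def)
  have P_bounds: "c \<le> x" "x \<le> a" "y \<le> d" "b \<le> y" if "(x, y) \<in> set P" for x y
    using bounds that by auto
  have "labelled_step F (c, Suc d) (c, d)"
    using bounds ann by (auto simp: labelled_step_def vertical_step_def)
  moreover have "(above a ((c, Suc d) # P) x y \<longrightarrow> F x y = max x y) \<and>
      (below ((c, Suc d) # P) x y \<longrightarrow> F x y = min x y)"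
    if xy: "x \<in> {c..Suc d}" "y \<in> {c..Suc d}"
      "(x, y) \<notin> set ((c, Suc d) # P)" "(y, x) \<notin> set ((c, Suc d) # P)"
      "(x, y) \<notin> {a..b} \<times> {a..b}" for x y
  proof (cases "x = Suc d \<or> y = Suc d")
    case True
    \<comment> \<open>Path points have abscissa at most \<open>d\<close> and ordinate at most
      \<open>Suc d\<close>, which excludes both ways of being below.\<close>
    have "\<not> below ((c, Suc d) # P) x y"
      using True xy bounds P_bounds unfolding below_def by fastforce
    then show ?thesis using True xy ann by auto
  next
    case False
    then have less: "x \<le> d" "y \<le> d" using xy by auto
    then have above: "above a ((c, Suc d) # P) x y = above a P x y"
      by (auto simp: above_def)
    \<comment> \<open>The new point affects \<open>below\<close> only if \<open>x = c\<close> or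
      \<open>y = c\<close>. The other coordinate is then at most \<open>d\<close>, and not
      \<open>d\<close> since the point is off the path, so \<open>(c, d)\<close> is already a
      witness.\<close>
    have "(c, d) \<in> set P" using P by simp
    then have "below P x y" if "below ((c, Suc d) # P) x y"
      using that xy less unfolding below_def by (auto intro: le_neq_implies_less)
    with above show ?thesis using vertical.IH less xy by (auto simp: described_on_def)
  qed
  moreover have "successively (labelled_step F) P" "projection_on {a..b} F"
    using vertical.IH by (auto simp: described_on_def)
  moreover have "set ((c, Suc d) # P) \<subseteq> {c..Suc d} \<times> {c..Suc d}"
    using bounds by fastforce
  ultimately show ?case
    using bounds unfolding described_on_def
    by (intro conjI ballI impI) (simp_all add: successively_Cons)
qed

section \<open>From the path description to a peeling\<close>

lemma labelled_path_bounds: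
  assumes "P \<noteq> []" "successively (labelled_step F) P"
  shows "set P \<subseteq> {fst (hd P)..fst (last P)} \<times> {snd (last P)..snd (hd P)}"
  using assms
proof (induction P rule: list_nonempty_induct)
  case (cons p P)
  then have "labelled_step F p (hd P)" "last P \<in> set P"
    by (auto simp: successively_Cons)
  moreover have bounds: "set P \<subseteq> {fst (hd P)..fst (last P)} \<times> {snd (last P)..snd (hd P)}"
    using cons by (auto simp: successively_Cons)
  ultimately have "fst p \<le> fst (hd P)" "snd (hd P) \<le> snd p"
    "fst (hd P) \<le> fst (last P)" "snd (last P) \<le> snd (hd P)"
    by (auto simp: labelled_step_def horizontal_step_def vertical_step_def)
  then have "set P \<subseteq> {fst p..fst (last P)} \<times> {snd (last P)..snd p}"
    "p \<in> {fst p..fst (last P)} \<times> {snd (last P)..snd p}"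
    using bounds by (auto simp: mem_Times_iff)
  then show ?case
    using \<open>P \<noteq> []\<close> by simp
qed auto

text \<open>The label of the first step gives \<open>F c d\<close> and \<open>F d c\<close> the same
  value, so an endpoint is an annihilator; the tail of the path describes \<open>F\<close> on the
  interval without it.\<close>

lemma peeling_if_described:
  assumes "quasitrivial_on {c..d} F" "nondecreasing_on {c..d} F" "described_on F a b c d P"
  shows "peeling F a b c d P"
  using assms
proof (induction P arbitrary: c d)
  case Nil
  then show ?case by (simp add: described_on_def)
next
  case (Cons p P)
  note D = Cons.prems(3)[unfolded described_on_def]
  have p: "p = (c, d)" using D by simp
  show ?case
  proof (cases P)
    case Nil
    then show ?thesis using D peeling.stop[of a b F] by auto
  next
    case (Cons r R)
    have cd: "c \<le> d" using D by auto
    have P: "P \<noteq> []" "successively (labelled_step F) P" "last P = (a, b)"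
      using D \<open>P = r # R\<close> by auto
    have ab: "a \<le> b" "b \<le> d" "projection_on {a..b} F" using D by auto
    \<comment> \<open>Adding \<open>p\<close> can only enlarge \<open>above\<close> and
      \<open>below\<close>, so the conditions pass to the tail. Points of the smaller square differ
      from \<open>p\<close> and its reflection.\<close>
    have off: "(above a P x y \<longrightarrow> F x y = max x y) \<and> (below P x y \<longrightarrow> F x y = min x y)"
      if "(x, y) \<in> {c..d} \<times> {c..d}" "(x, y) \<noteq> p" "(y, x) \<noteq> p"
        "(x, y) \<notin> set P" "(y, x) \<notin> set P" "(x, y) \<notin> {a..b} \<times> {a..b}" for x y
    proof -
      have "above a P x y \<Longrightarrow> above a (p # P) x y" "below P x y \<Longrightarrow> below (p # P) x y"
        by (auto simp: above_def below_def)
      then show ?thesis using D that by auto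
    qed
    have last: "(a, b) \<in> set P" using P by (metis last_in_set)
    have "successively (labelled_step F) (p # r # R)"
      using D unfolding \<open>P = r # R\<close> by blast
    then have "labelled_step F p r" by simp
    then consider (hor) "horizontal_step p r" "F c d = c" "F d c = c"
      | (ver) "vertical_step p r" "F c d = d" "F d c = d"
      using cd by (auto simp: labelled_step_def p)
    then show ?thesis
    proof cases
      case hor
      have hd: "hd P = (Suc c, d)"
        using hor(1) \<open>P = r # R\<close> by (auto simp: horizontal_step_def p prod_eq_iff)
      have set: "set P \<subseteq> {Suc c..a} \<times> {b..d}"
        using labelled_path_bounds[OF P(1,2)] hd P(3) by simp
      have sub: "{Suc c..d} \<subseteq> {c..d}" by auto
      have "described_on F a b (Suc c) d P"
        unfolding described_on_def
      proof (intro conjI ballI impI)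
        \<comment> \<open>The end \<open>(a, b)\<close> belongs to the tail, so the rectangle bound
          keeps \<open>a\<close> and \<open>b\<close> away from the removed endpoint
          \<open>c\<close>.\<close>
        show "a \<in> {Suc c..d}" "b \<in> {Suc c..d}"
          using set last ab(1) by auto
        then show "set P \<subseteq> {Suc c..d} \<times> {Suc c..d}"
          using set by auto
        fix x y
        assume "x \<in> {Suc c..d}" "y \<in> {Suc c..d}" "(x, y) \<notin> set P" "(y, x) \<notin> set P"
          "(x, y) \<notin> {a..b} \<times> {a..b}"
        then have "(above a P x y \<longrightarrow> F x y = max x y) \<and> (below P x y \<longrightarrow> F x y = min x y)"
          by (intro off) (auto simp: p)
        then show "above a P x y \<Longrightarrow> F x y = max x y" "below P x y \<Longrightarrow> F x y = min x y"
          by blast+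
      qed (use P ab hd in simp_all)
      then show ?thesis
        using Cons.IH quasitrivial_on_subset[OF Cons.prems(1) sub]
          nondecreasing_on_subset[OF Cons.prems(2) sub] p
          annihilator_on_lower[OF Cons.prems(1,2) hor(2,3)] peeling.horizontal by blast
    next
      case ver
      obtain e where e: "d = Suc e" and hd: "hd P = (c, e)"
        using ver(1) \<open>P = r # R\<close> by (cases r) (auto simp: vertical_step_def p)
      have set: "set P \<subseteq> {c..a} \<times> {b..e}"
        using labelled_path_bounds[OF P(1,2)] hd P(3) by simp
      have sub: "{c..e} \<subseteq> {c..d}" using e by auto
      have "described_on F a b c e P"
        unfolding described_on_def
      proof (intro conjI ballI impI)
        show "a \<in> {c..e}" "b \<in> {c..e}"
          using set last ab(1) by auto
        then show "set P \<subseteq> {c..e} \<times> {c..e}"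
          using set by auto
        fix x y
        assume "x \<in> {c..e}" "y \<in> {c..e}" "(x, y) \<notin> set P" "(y, x) \<notin> set P"
          "(x, y) \<notin> {a..b} \<times> {a..b}"
        then have "(above a P x y \<longrightarrow> F x y = max x y) \<and> (below P x y \<longrightarrow> F x y = min x y)"
          by (intro off) (auto simp: p e)
        then show "above a P x y \<Longrightarrow> F x y = max x y" "below P x y \<Longrightarrow> F x y = min x y"
          by blast+
      qed (use P ab hd in simp_all)
      then show ?thesis
        using Cons.IH quasitrivial_on_subset[OF Cons.prems(1) sub]
          nondecreasing_on_subset[OF Cons.prems(2) sub] p e
          annihilator_on_upper[OF Cons.prems(1,2) ver(2,3)] peeling.vertical by blast
    qed
  qed
qed

theorem theorem5p3:
  fixes k :: nat and F :: "nat \<Rightarrow> nat \<Rightarrow> nat"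
  assumes "k \<ge> 1"
    and "operation_on (L k) F"
    and "quasitrivial_on (L k) F"
    and "nondecreasing_on (L k) F"
  shows "(bisymmetric_on (L k) F \<longleftrightarrow> (\<exists>a b P. described_by_path k F a b P)) \<and>
    (\<forall>a b P. described_by_path k F a b P \<longrightarrow>
       (\<forall>(x, y)\<in>L k \<times> L k - {a..b} \<times> {a..b}. F x y = F y x) \<and>
       projection_on {a..b} F)"
proof -
  have q: "quasitrivial_on {1..k} F" and n: "nondecreasing_on {1..k} F"
    using assms(3,4) unfolding L_def .
  \<comment> \<open>For the given \<open>F\<close>, describing paths and peelings of
    \<open>{1..k}\<close> coincide, so both claims become statements about peelings.\<close>
  have iff: "described_by_path k F a b P \<longleftrightarrow> peeling F a b 1 k P" for a b P
    using described_by_path_iff described_if_peeling peeling_if_described[OF q n] by blast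
  have "bisymmetric_on {1..k} F \<longleftrightarrow> (\<exists>a b P. peeling F a b 1 k P)"
    using peeling_if_bisymmetric[OF q n _ assms(1)] bisymmetric_if_peeling[OF _ q] by blast
  moreover have "(\<forall>(x, y)\<in>{1..k} \<times> {1..k} - {a..b} \<times> {a..b}. F x y = F y x) \<and>
      projection_on {a..b} F" if "peeling F a b 1 k P" for a b P
    using symmetric_if_peeling[OF that] projection_if_peeling[OF that] by blast
  ultimately show ?thesis
    unfolding iff L_def by blast
qed

end
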